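(* Let $P=\{x\in M_{\mathbb R}:\langle a_i,x\rangle+b_i\ge0,\ i=1,\dots,m\}$ be a simple convex $n$-dimensional polytope with exactly $m$ facets, where $a_1,\dots,a_m\in N$ are primitive vectors and $b_1,\dots,b_m\in\mathbb Z$. Let $\Sigma_P$ be its normal fan, and let $\mathcal Z_P\subset\mathbb C^m$, $U(\Sigma_P)\subset\mathbb C^m$ and $\mathcal Z(\Sigma_P)\subset\mathbb C^m$ be the associated spaces (defined in the context). Then: (a) $\mathcal Z_P\subset U(\Sigma_P)$. (b) There is a $\mathbb T^m$-equivariant homeomorphism $\mathcal Z_P\cong\mathcal Z(\Sigma_P)$.
   Context: $N\cong\mathbb Z^n$ is a lattice, $N_{\mathbb R}=N\otimes_{\mathbb Z}\mathbb R$, and $M_{\mathbb R}=(N_{\mathbb R})^*$ is the dual vector space. The set $P$ is assumed bounded, with affine hull all of $M_{\mathbb R}$, and such that for each $i$ the intersection $F_i$ of $P$ with the hyperplane $\langle a_i,x\rangle+b_i=0$ spans an affine subspace of dimension $n-1$ (no inequality is redundant); so $P$ has exactly the $m$ facets $F_1,\dots,F_m$. $P$ is simple if exactly $n$ facets meet at each vertex. The normal fan $\Sigma_P$ is the collection of cones $\sigma_Q$, $Q$ a face of $P$, where $\sigma_Q\subset N_{\mathbb R}$ is the cone of nonnegative combinations of those $a_i$ with $Q\subset F_i$. It is a complete fan, and simplicial since $P$ is simple; its one-dimensional cones are generated by $a_1,\dots,a_m$. For $\sigma\in\Sigma_P$ let $g(\sigma)\subseteq\{1,\dots,m\}$ be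 the set of indices $i$ such that $a_i$ is a generator of $\sigma$ (spans a one-dimensional face of $\sigma$). A subset of $\{1,\dots,m\}$ is called a $g$-subset if it is contained in $g(\sigma)$ for some $\sigma\in\Sigma_P$. Define $$U(\Sigma_P)=\mathbb C^m\setminus\bigcup_{\{i_1,\dots,i_k\}\text{ not a }g\text{-subset}}\{z\in\mathbb C^m: z_{i_1}=\dots=z_{i_k}=0\},$$ $$\mathcal Z(\Sigma_P)=\bigcup_{\sigma\in\Sigma_P}\{z\in\mathbb C^m: |z_j|\le 1\text{ for all }j,\ |z_j|=1\text{ if }j\notin g(\sigma)\}.$$ Let $i_P\colon M_{\mathbb R}\to\mathbb R^m$ be the affine injection $i_P(x)=(\langle a_1,x\rangle+b_1,\dots,\langle a_m,x\rangle+b_m)$, and $\varrho\colon\mathbb C^m\to\mathbb R^m$, $\varrho(z_1,\dots,z_m)=(|z_1|^2,\dots,|z_m|^2)$. The space $\mathcal Z_P$ is the pullback of $i_P|_P\colon P\to\mathbb R^m$ along $\varrho$; its projection $i_Z\colon\mathcal Z_P\to\mathbb C^m$ is an embedding and is used to regard $\mathcal Z_P$ as a subset of $\mathbb C^m$, namely $\mathcal Z_P=\{z\in\mathbb C^m:(|z_1|^2,\dots,|z_m|^2)\in i_P(P)\}$. The torus $\mathbb T^m=(\mathbb S^1)^m$, $\mathbb S^1=\{z\in\mathbb C:|z|=1\}$, acts on $\mathbb C^m$ coordinatewise, preserving all these subsets. *)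

theory Defs
  imports "HOL-Analysis.Analysis"
begin

text \<open>
  Conventions. The lattice \<open>N\<close> is \<open>int ^ 'n\<close>, with \<open>N\<^sub>\<real> = real ^ 'n\<close>; the dual space
  \<open>M\<^sub>\<real>\<close> is also \<open>real ^ 'n\<close> (dual basis coordinates), so that the pairing is the
  inner product. Thus \<open>n = CARD('n)\<close>, and the indices \<open>1, \<dots>, m\<close> form the finite type
  \<open>'m\<close>, so that \<open>m = CARD('m)\<close>.
\<close>

definition real_vec :: "int ^ 'n \<Rightarrow> real ^ 'n"
  where "real_vec v = (\<chi> k. real_of_int (v $ k))"

text \<open>The zero vector is not primitive: it is \<open>0\<close> times itself.\<close>
definition primitive_vec :: "int ^ 'n \<Rightarrow> bool"
  where "primitive_vec v \<longleftrightarrow> (\<forall>c w. v = c *s w \<longrightarrow> \<bar>c\<bar> = 1)"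

definition iP :: "('m \<Rightarrow> int ^ 'n) \<Rightarrow> ('m \<Rightarrow> int) \<Rightarrow> real ^ 'n \<Rightarrow> real ^ 'm"
  where "iP a b x = (\<chi> i. real_vec (a i) \<bullet> x + real_of_int (b i))"

definition polyP :: "('m \<Rightarrow> int ^ 'n) \<Rightarrow> ('m \<Rightarrow> int) \<Rightarrow> (real ^ 'n) set"
  where "polyP a b = {x. \<forall>i. real_vec (a i) \<bullet> x + real_of_int (b i) \<ge> 0}"

definition facetP :: "('m \<Rightarrow> int ^ 'n) \<Rightarrow> ('m \<Rightarrow> int) \<Rightarrow> 'm \<Rightarrow> (real ^ 'n) set"
  where "facetP a b i = polyP a b \<inter> {x. real_vec (a i) \<bullet> x + real_of_int (b i) = 0}"

text \<open>
  Each \<open>facetP a b i\<close> having dimension \<open>n - 1\<close> does not exclude listing the same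
  inequality twice; the cardinality condition does.
\<close>
definition polytope_presentation :: "('m::finite \<Rightarrow> int ^ 'n) \<Rightarrow> ('m \<Rightarrow> int) \<Rightarrow> bool"
  where "polytope_presentation a b \<longleftrightarrow>
    bounded (polyP a b) \<and>
    affine hull (polyP a b) = UNIV \<and>
    (\<forall>i. aff_dim (facetP a b i) = int CARD('n) - 1) \<and>
    card {F. F facet_of polyP a b} = CARD('m)"

definition simple_polytope :: "(real ^ 'n) set \<Rightarrow> bool"
  where "simple_polytope P \<longleftrightarrow>
    (\<forall>v. v extreme_point_of P \<longrightarrow> card {F. F facet_of P \<and> v \<in> F} = CARD('n))"

definition sigma_cone ::
    "('m::finite \<Rightarrow> int ^ 'n) \<Rightarrow> ('m \<Rightarrow> int) \<Rightarrow> (real ^ 'n) set \<Rightarrow> (real ^ 'n) set"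
  where "sigma_cone a b Q =
    {(\<Sum>i \<in> {i. Q \<subseteq> facetP a b i}. c i *\<^sub>R real_vec (a i)) | c. \<forall>i. c i \<ge> (0::real)}"

text \<open>
  In the library the empty set is a face. It is excluded here, since its cone would be
  generated by all of the \<open>a i\<close>; the face \<open>Q = P\<close> gives the zero cone.
\<close>
definition normal_fan :: "('m::finite \<Rightarrow> int ^ 'n) \<Rightarrow> ('m \<Rightarrow> int) \<Rightarrow> (real ^ 'n) set set"
  where "normal_fan a b = {sigma_cone a b Q | Q. Q face_of polyP a b \<and> Q \<noteq> {}}"

definition gens :: "('m \<Rightarrow> int ^ 'n) \<Rightarrow> (real ^ 'n) set \<Rightarrow> 'm set"
  where "gens a \<sigma> = {i. {t *\<^sub>R real_vec (a i) | t. t \<ge> (0::real)} edge_of \<sigma>}"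

definition g_subset :: "('m \<Rightarrow> int ^ 'n) \<Rightarrow> (real ^ 'n) set set \<Rightarrow> 'm set \<Rightarrow> bool"
  where "g_subset a \<Sigma> I \<longleftrightarrow> (\<exists>\<sigma> \<in> \<Sigma>. I \<subseteq> gens a \<sigma>)"

definition U_fan :: "('m \<Rightarrow> int ^ 'n) \<Rightarrow> (real ^ 'n) set set \<Rightarrow> (complex ^ 'm) set"
  where "U_fan a \<Sigma> = UNIV - \<Union>{{z. \<forall>i \<in> I. z $ i = 0} | I. \<not> g_subset a \<Sigma> I}"

definition Z_fan :: "('m \<Rightarrow> int ^ 'n) \<Rightarrow> (real ^ 'n) set set \<Rightarrow> (complex ^ 'm) set"
  where "Z_fan a \<Sigma> =
    (\<Union>\<sigma> \<in> \<Sigma>. {z. (\<forall>j. cmod (z $ j) \<le> 1) \<and> (\<forall>j. j \<notin> gens a \<sigma> \<longrightarrow> cmod (z $ j) = 1)})"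

definition rho :: "complex ^ 'm \<Rightarrow> real ^ 'm"
  where "rho z = (\<chi> i. (cmod (z $ i))\<^sup>2)"

text \<open>The pullback of \<open>iP\<close> (restricted to \<open>P\<close>) along \<open>rho\<close>, regarded as a subset of
  \<open>complex ^ 'm\<close>.\<close>
definition Z_poly :: "('m \<Rightarrow> int ^ 'n) \<Rightarrow> ('m \<Rightarrow> int) \<Rightarrow> (complex ^ 'm) set"
  where "Z_poly a b = {z. rho z \<in> iP a b ` polyP a b}"

text \<open>The torus acts by the library multiplication on \<open>complex ^ 'm\<close>, which is
  componentwise: \<open>(t * z) $ i = t $ i * z $ i\<close>.\<close>
definition torus :: "(complex ^ 'm) set"
  where "torus = {t. \<forall>i. cmod (t $ i) = 1}"

end

(* Both spaces meet every orbit of the real group {exp(gamma) : sum_i gamma_i a_i = 0}, acting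
   on the points of C^m whose zero coordinates are indexed by facets with a common point, in
   exactly one point (on coordinates that vanish, gamma is irrelevant).  Following the orbits
   gives the map from Z_P to Z(Sigma_P), which is equivariant because the group commutes with
   the torus.  Its inverse minimises an entropy over a face of P, where strict monotonicity of
   the logarithm gives uniqueness; the map itself is read off the basis of active normals at an
   optimum of a linear functional on P, and uniqueness is the fan property.  The orbit relation
   is closed, being given by binomial equations, so compactness makes the map a homeomorphism. *)

theory Submission
  imports Defs
begin

subsection \<open>Faces and vertices of a simple polytope\<close>

text \<open>Linear relations sum gamma_i a_i = 0 are not solved for but tested: gamma is one iff sum
  gamma_i (\<open>A i\<close> . u) = 0 for every u. A vanishing coordinate leaves gamma_i free,
  which dually restricts u to directions with \<open>A i\<close> . u = 0 for those i, that is,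
  directions along the face where those facets meet. If x and y lie in that face, u = x - y
  qualifies, and \<open>A i\<close> . u is the difference of the slacks of x and y. Both uniqueness
  proofs pair logarithms with slack differences and find a sum of terms of one sign; the entropy
  yields the same pairing as its stationarity condition, and the binomials have slacks as exponents.
  Simplicity enters through the dual basis at a point x: the normals active at x are independent, so
  any chosen facets through x can be left while the others are kept. The obstacle is continuity at
  the coordinate hyperplanes, where logarithms blow up and the active set jumps; this is why the map
  is controlled through its graph and not through its construction.\<close>

locale simple_presentation =
  fixes a :: "'m::finite \<Rightarrow> int ^ 'n::finite" and b :: "'m \<Rightarrow> int"
  assumes presentation: "polytope_presentation a b"
    and simple: "simple_polytope (polyP a b)"
begin

abbreviation A :: "'m \<Rightarrow> real ^ 'n" where "A i \<equiv> real_vec (a i)"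

abbreviation P :: "(real ^ 'n) set" where "P \<equiv> polyP a b"

definition slack :: "real ^ 'n \<Rightarrow> 'm \<Rightarrow> real"
  where "slack x i = A i \<bullet> x + real_of_int (b i)"

definition active :: "real ^ 'n \<Rightarrow> 'm set"
  where "active x = {i. slack x i = 0}"

definition face_on :: "'m set \<Rightarrow> (real ^ 'n) set"
  where "face_on I = {x \<in> P. I \<subseteq> active x}"

lemma mem_P: "x \<in> P \<longleftrightarrow> (\<forall>i. 0 \<le> slack x i)"
  by (simp add: polyP_def slack_def)

lemma slack_diff: "slack x i - slack y i = A i \<bullet> (x - y)"
  by (simp add: slack_def inner_diff_right)

lemma slack_add: "slack (x + t *\<^sub>R u) i = slack x i + t * (A i \<bullet> u)"
  by (simp add: slack_def inner_add_right)

lemma slack_convex_comb: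
  "slack ((1 - t) *\<^sub>R x + t *\<^sub>R y) i = (1 - t) * slack x i + t * slack y i"
  by (simp add: slack_def inner_add_right algebra_simps)

lemma continuous_on_slack: "continuous_on S (\<lambda>x. slack x i)"
  unfolding slack_def by (intro continuous_intros)

lemma facetP_eq: "facetP a b i = {x \<in> P. i \<in> active x}"
  by (auto simp: facetP_def active_def slack_def)

lemma active_nonactive_pos: "x \<in> P \<Longrightarrow> i \<notin> active x \<Longrightarrow> 0 < slack x i"
  by (metis active_def less_eq_real_def mem_Collect_eq mem_P)

lemma convex_P: "convex P"
  unfolding convex_alt by (auto simp: mem_P slack_convex_comb)

lemma closed_P: "closed P"
proof -
  have "P = (\<Inter>i. {x. 0 \<le> slack x i})" by (auto simp: mem_P)
  then show ?thesis
    by (auto intro!: closed_Collect_le continuous_intros continuous_on_slack)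
qed

lemma compact_P: "compact P"
  using presentation closed_P by (simp add: polytope_presentation_def compact_eq_bounded_closed)

lemma facetP_face: "facetP a b i face_of P"
proof -
  have eq: "facetP a b i = P \<inter> {x. A i \<bullet> x = - real_of_int (b i)}"
    by (auto simp: facetP_def)
  show ?thesis unfolding eq
    by (rule face_of_Int_supporting_hyperplane_ge[OF convex_P])
       (simp add: polyP_def, smt (verit))
qed

lemma facetP_aff_dim: "aff_dim (facetP a b i) = int CARD('n) - 1"
  using presentation by (simp add: polytope_presentation_def)

lemma facetP_nonempty: "facetP a b i \<noteq> {}"
  using facetP_aff_dim[of i] zero_less_card_finite[where 'a='n] by fastforce

lemma aff_dim_P: "aff_dim P = int CARD('n)"
  using presentation aff_dim_eq_full[of P] by (simp add: polytope_presentation_def)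

lemma face_on_face: "face_on I face_of P"
proof (cases "I = {}")
  case True
  then show ?thesis by (simp add: face_on_def face_of_refl convex_P)
next
  case False
  have "face_on I = \<Inter>(facetP a b ` I)"
    using False by (auto simp: face_on_def facetP_eq)
  then show ?thesis
    using False by (auto intro!: face_of_Inter facetP_face)
qed

lemma face_on_compact: "compact (face_on I)"
  using compact_P convex_P face_of_imp_compact face_on_face by blast

text \<open>A relative interior point of \<open>F\<close> lies on some bounding hyperplane, for
  otherwise it would be interior to \<open>P\<close> and force \<open>F = P\<close>. Then
  \<open>F\<close> is a face of that \<open>facetP a b i\<close> of equal dimension.\<close>

lemma facet_eq_facetP:
  assumes F: "F facet_of P"
  shows "\<exists>i. F = facetP a b i"
proof -
  have face: "F face_of P" and ne: "F \<noteq> {}" and dim: "aff_dim F = int CARD('n) - 1"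
    using F aff_dim_P by (auto simp: facet_of_def)
  have cF: "convex F" using face face_of_imp_convex by blast
  then obtain x where x: "x \<in> rel_interior F"
    using ne rel_interior_eq_empty by blast
  then have xF: "x \<in> F" using rel_interior_subset by blast
  then have xP: "x \<in> P" using face face_of_imp_subset by blast
  have "\<exists>i. i \<in> active x"
  proof (rule ccontr)
    assume "\<nexists>i. i \<in> active x"
    then have pos: "\<forall>i. 0 < slack x i" using active_nonactive_pos xP by blast
    have "open {x. \<forall>i. 0 < slack x i}"
      by (auto simp: Collect_all_eq intro!: open_Collect_less continuous_on_slack continuous_intros)
    moreover have "{x. \<forall>i. 0 < slack x i} \<subseteq> P"
      by (auto simp: mem_P less_imp_le)
    ultimately have "x \<in> interior P" using pos by (auto simp: interior_def)
    then have "x \<in> rel_interior P" using interior_subset_rel_interior by blast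
    then have "P \<subseteq> F" using subset_of_face_of[OF face order_refl] xF by blast
    then have "F = P" using face face_of_imp_subset by blast
    then show False using dim aff_dim_P by simp
  qed
  then obtain i where i: "i \<in> active x" ..
  then have "x \<in> facetP a b i" using xP by (simp add: facetP_eq)
  then have sub: "F \<subseteq> facetP a b i"
    using subset_of_face_of[OF facetP_face face_of_imp_subset[OF face]] x by blast
  then have "F face_of facetP a b i"
    using face face_of_imp_subset[OF facetP_face] face_of_subset by blast
  then have "F = facetP a b i"
    using face_of_aff_dim_lt[of "facetP a b i" F] face_of_imp_convex[OF facetP_face]
      dim facetP_aff_dim by fastforce
  then show ?thesis ..
qed

lemma facets_eq: "{F. F facet_of P} = range (facetP a b)"
  using facet_eq_facetP facetP_face facetP_nonempty aff_dim_P
  by (auto simp: facet_of_def facetP_aff_dim)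

text \<open>There are as many facets as indices, so the surjection from indices to facets is
  injective.\<close>

lemma inj_facetP: "inj (facetP a b)"
proof -
  have "card (range (facetP a b)) = CARD('m)"
    using presentation facets_eq by (simp add: polytope_presentation_def)
  then show ?thesis by (intro eq_card_imp_inj_on) auto
qed

text \<open>Simplicity counts facets as sets; injectivity of \<open>facetP a b\<close> turns this
  into a count of indices.\<close>

lemma card_active_extreme:
  assumes v: "v extreme_point_of P"
  shows "card (active v) = CARD('n)"
proof -
  have "v \<in> P" using v by (simp add: extreme_point_of_def)
  then have "{F. F facet_of P \<and> v \<in> F} = facetP a b ` active v"
    using facets_eq by (auto simp: facetP_eq)
  then have "card (facetP a b ` active v) = CARD('n)"
    using simple v unfolding simple_polytope_def by metis
  then show ?thesis
    using card_image[OF inj_on_subset[OF inj_facetP subset_UNIV]] by metis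
qed

section \<open>Small moves inside \<open>P\<close> and the dual basis at a point\<close>

lemma feasible_direction:
  assumes x: "x \<in> P" and u: "\<And>i. i \<in> active x \<Longrightarrow> 0 \<le> A i \<bullet> u"
  obtains e where "0 < e"
    "\<And>t. 0 \<le> t \<Longrightarrow> t \<le> e \<Longrightarrow> x + t *\<^sub>R u \<in> P"
    "\<And>t i. 0 \<le> t \<Longrightarrow> t \<le> e \<Longrightarrow> i \<notin> active x \<Longrightarrow> 0 < slack (x + t *\<^sub>R u) i"
proof -
  have "eventually (\<lambda>t. \<forall>i. i \<notin> active x \<longrightarrow> 0 < slack (x + t *\<^sub>R u) i) (at_right 0)"
  proof (intro eventually_all_finite)
    fix i
    show "eventually (\<lambda>t. i \<notin> active x \<longrightarrow> 0 < slack (x + t *\<^sub>R u) i) (at_right 0)"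
    proof (cases "i \<in> active x")
      case False
      have "((\<lambda>t. slack (x + t *\<^sub>R u) i) \<longlongrightarrow> slack x i + 0 * (A i \<bullet> u)) (at_right 0)"
        unfolding slack_add by (intro tendsto_intros)
      then have "eventually (\<lambda>t. 0 < slack (x + t *\<^sub>R u) i) (at_right 0)"
        by (rule order_tendstoD) (use active_nonactive_pos[OF x False] in simp)
      then show ?thesis by eventually_elim simp
    qed simp
  qed
  then obtain e where e: "0 < e"
    and *: "\<And>t i. 0 < t \<Longrightarrow> t < e \<Longrightarrow> i \<notin> active x \<Longrightarrow> 0 < slack (x + t *\<^sub>R u) i"
    unfolding eventually_at_right_field by blast
  \<comment> \<open>Halving \<open>e\<close> replaces the open interval by a closed one;
    \<open>t = 0\<close> is outside the one-sided limit and is treated separately.\<close>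
  have pos: "0 < slack (x + t *\<^sub>R u) i" if "0 \<le> t" "t \<le> e/2" "i \<notin> active x" for t i
  proof (cases "t = 0")
    case True
    then show ?thesis using active_nonactive_pos[OF x] that by simp
  next
    case False
    then show ?thesis using that e * by simp
  qed
  show thesis
  proof (rule that[of "e/2"])
    show "0 < e/2" using e by simp
    show "x + t *\<^sub>R u \<in> P" if t: "0 \<le> t" "t \<le> e/2" for t
      unfolding mem_P
    proof
      fix i
      show "0 \<le> slack (x + t *\<^sub>R u) i"
      proof (cases "i \<in> active x")
        case True
        then have "slack x i = 0" by (simp add: active_def)
        then show ?thesis using u[OF True] t by (simp add: slack_add)
      next
        case False
        then show ?thesis using pos[OF t] by (simp add: less_imp_le)
      qed
    qed
  qed (use pos in auto)
qed

lemma feasible_line: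
  assumes x: "x \<in> P" and u: "\<And>i. i \<in> active x \<Longrightarrow> A i \<bullet> u = 0"
  obtains e where "0 < e"
    "\<And>t. \<bar>t\<bar> \<le> e \<Longrightarrow> x + t *\<^sub>R u \<in> P \<and> active (x + t *\<^sub>R u) = active x"
proof -
  have nonneg: "0 \<le> A i \<bullet> u" "0 \<le> A i \<bullet> (- u)" if "i \<in> active x" for i
    using u[OF that] by simp_all
  obtain e1 where e1: "0 < e1"
    "\<And>t. 0 \<le> t \<Longrightarrow> t \<le> e1 \<Longrightarrow> x + t *\<^sub>R u \<in> P"
    "\<And>t i. 0 \<le> t \<Longrightarrow> t \<le> e1 \<Longrightarrow> i \<notin> active x \<Longrightarrow> 0 < slack (x + t *\<^sub>R u) i"
    using feasible_direction[OF x nonneg(1)] by blast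
  obtain e2 where e2: "0 < e2"
    "\<And>t. 0 \<le> t \<Longrightarrow> t \<le> e2 \<Longrightarrow> x + t *\<^sub>R (- u) \<in> P"
    "\<And>t i. 0 \<le> t \<Longrightarrow> t \<le> e2 \<Longrightarrow> i \<notin> active x \<Longrightarrow> 0 < slack (x + t *\<^sub>R (- u)) i"
    using feasible_direction[OF x nonneg(2)] by blast
  show thesis
  proof (rule that[of "min e1 e2"])
    show "0 < min e1 e2" using e1(1) e2(1) by simp
    fix t :: real assume t: "\<bar>t\<bar> \<le> min e1 e2"
    have "x + t *\<^sub>R u \<in> P \<and> (\<forall>i. i \<notin> active x \<longrightarrow> 0 < slack (x + t *\<^sub>R u) i)"
      using e1(2,3)[of t] e2(2,3)[of "- t"] t by (cases "0 \<le> t") auto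
    moreover have "slack (x + t *\<^sub>R u) i = 0" if "i \<in> active x" for i
      using u[OF that] that by (simp add: slack_add active_def)
    ultimately show "x + t *\<^sub>R u \<in> P \<and> active (x + t *\<^sub>R u) = active x"
      unfolding active_def by force
  qed
qed

text \<open>Otherwise a short segment through \<open>v\<close> in the direction \<open>u\<close>
  would stay in \<open>P\<close>.\<close>

lemma extreme_active_injective:
  assumes v: "v extreme_point_of P" and u: "\<And>i. i \<in> active v \<Longrightarrow> A i \<bullet> u = 0"
  shows "u = 0"
proof (rule ccontr)
  assume u0: "u \<noteq> 0"
  have "v \<in> P" using v by (simp add: extreme_point_of_def)
  then obtain e where e: "0 < e" "\<And>t. \<bar>t\<bar> \<le> e \<Longrightarrow> v + t *\<^sub>R u \<in> P"
    using feasible_line u by metis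
  have "midpoint (v + e *\<^sub>R u) (v + (-e) *\<^sub>R u) = v"
    by (simp add: midpoint_def scaleR_add_right[symmetric] flip: scaleR_2)
  moreover have "v + e *\<^sub>R u \<noteq> v + (-e) *\<^sub>R u"
    using u0 e(1) unfolding add_left_cancel scaleR_cancel_right by simp
  ultimately have "v \<in> open_segment (v + e *\<^sub>R u) (v + (-e) *\<^sub>R u)"
    by (metis midpoint_in_open_segment)
  then show False
    using v e(2)[of e] e(2)[of "-e"] e(1) unfolding extreme_point_of_def by auto
qed

text \<open>At a vertex, exactly \<open>n\<close> normals are active and they separate points, so they form a
  basis of \<open>N\<^sub>\<real>\<close>; the \<open>d j\<close> are the dual basis.\<close>
lemma dual_basis_extreme:
  assumes v: "v extreme_point_of P"
  shows "\<exists>d. \<forall>i\<in>active v. \<forall>j\<in>active v. A i \<bullet> d j = (if i = j then 1 else 0)"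
proof -
  obtain p :: "'n \<Rightarrow> 'm" where p: "bij_betw p UNIV (active v)"
    using finite_same_card_bij[of "UNIV :: 'n set" "active v"] card_active_extreme[OF v] by auto
  define T where "T u = (\<chi> k. A (p k) \<bullet> u)" for u
  have lin: "linear T"
    by (rule linearI) (simp_all add: T_def vec_eq_iff inner_add_right)
  have "inj T"
    unfolding linear_injective_0[OF lin]
  proof (intro allI impI)
    fix u assume "T u = 0"
    then have *: "A (p k) \<bullet> u = 0" for k by (simp add: T_def vec_eq_iff)
    have "A i \<bullet> u = 0" if "i \<in> active v" for i
      using that p * unfolding bij_betw_def by (metis rangeE)
    then show "u = 0" using extreme_active_injective[OF v] by blast
  qed
  then have "surj T" using lin linear_injective_imp_surjective by blast
  then obtain d where d: "\<And>y. T (d y) = y" by (metis surjD)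
  define d' where "d' j = d (\<chi> k. if p k = j then 1 else 0)" for j
  have "A (p k) \<bullet> d' j = (if p k = j then 1 else 0)" for k j
    using d[of "\<chi> k. if p k = j then 1 else 0"] by (simp add: d'_def T_def vec_eq_iff)
  then show ?thesis using p unfolding bij_betw_def by (metis imageE)
qed

text \<open>The smallest face containing \<open>x\<close> has a vertex, at which every facet active
  at \<open>x\<close> is still active; its dual basis restricts to \<open>active x\<close>.\<close>

lemma dual_basis:
  assumes x: "x \<in> P"
  obtains d where "\<And>i j. i \<in> active x \<Longrightarrow> j \<in> active x \<Longrightarrow> A i \<bullet> d j = (if i = j then 1 else 0)"
proof -
  have "face_on (active x) \<noteq> {}" using x by (auto simp: face_on_def)
  then obtain v where "v extreme_point_of face_on (active x)"
    using extreme_point_exists_convex face_on_compact face_of_imp_convex[OF face_on_face] by metis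
  then have v: "v extreme_point_of P" "active x \<subseteq> active v"
    using extreme_point_of_face[OF face_on_face] by (auto simp: face_on_def)
  then show thesis using dual_basis_extreme that by (meson subsetD)
qed

text \<open>Moving along the sum of the dual vectors outside \<open>J\<close> leaves exactly those
  facets. On the fan side: any subset of the generators of a cone again generates a cone of the
  fan.\<close>

lemma active_subset_realized:
  assumes x: "x \<in> P" and J: "J \<subseteq> active x"
  obtains y where "y \<in> P" "active y = J"
proof -
  obtain d where d: "\<And>i j. i \<in> active x \<Longrightarrow> j \<in> active x \<Longrightarrow> A i \<bullet> d j = (if i = j then 1 else 0)"
    using dual_basis[OF x] by blast
  define u where "u = (\<Sum>j\<in>active x - J. d j)"
  have u: "A i \<bullet> u = (if i \<in> J then 0 else 1)" if "i \<in> active x" for i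
    using that d by (simp add: u_def inner_sum_right)
  have nonneg: "0 \<le> A i \<bullet> u" if "i \<in> active x" for i using u[OF that] by simp
  obtain e where e: "0 < e" "\<And>t. 0 \<le> t \<Longrightarrow> t \<le> e \<Longrightarrow> x + t *\<^sub>R u \<in> P"
    "\<And>t i. 0 \<le> t \<Longrightarrow> t \<le> e \<Longrightarrow> i \<notin> active x \<Longrightarrow> 0 < slack (x + t *\<^sub>R u) i"
    using feasible_direction[OF x nonneg] by blast
  have "active (x + e *\<^sub>R u) = J"
  proof -
    have "slack (x + e *\<^sub>R u) i = 0 \<longleftrightarrow> i \<in> J" for i
    proof (cases "i \<in> active x")
      case True
      then show ?thesis using u[OF True] e(1) by (simp add: slack_add active_def)
    next
      case False
      then show ?thesis using e(3)[of e i] e(1) J by force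
    qed
    then show ?thesis by (auto simp: active_def)
  qed
  moreover have "x + e *\<^sub>R u \<in> P" using e(1) by (intro e(2)) simp_all
  ultimately show thesis using that by blast
qed

section \<open>Facet normals, their cones and the normal fan\<close>

lemma A_nonzero: "A i \<noteq> 0"
proof
  assume "A i = 0"
  moreover obtain y where "y \<in> facetP a b i" using facetP_nonempty by blast
  ultimately have "facetP a b i = P" by (auto simp: facetP_def)
  then show False using facetP_aff_dim[of i] aff_dim_P by simp
qed

text \<open>The two slacks differ by a scaling and an offset \<open>k\<close>. A point of facet i
  gives \<open>k\<close> nonnegative, a point of facet j gives it nonpositive, so the facets
  coincide.\<close>

lemma A_parallel_eq:
  assumes t: "A j = t *\<^sub>R A i" "0 < t"
  shows "i = j"
proof -
  define k where "k = of_int (b j) - t * of_int (b i)"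
  have s: "slack x j = t * slack x i + k" for x
    by (simp add: slack_def t k_def algebra_simps)
  obtain y y' where y: "y \<in> P" "slack y i = 0" "y' \<in> P" "slack y' j = 0"
    using facetP_nonempty[of i] facetP_nonempty[of j] by (auto simp: facetP_eq active_def)
  have "0 \<le> k" using s[of y] y by (metis add_0 mem_P mult_zero_right)
  moreover have "k \<le> 0" using s[of y'] y t(2) by (smt (verit) mem_P mult_nonneg_nonneg)
  ultimately have "slack x j = 0 \<longleftrightarrow> slack x i = 0" for x using s[of x] t(2) by simp
  then have "facetP a b i = facetP a b j" by (auto simp: facetP_eq active_def)
  then show ?thesis using inj_facetP by (simp add: inj_eq)
qed

definition cone_on :: "'m set \<Rightarrow> (real ^ 'n) set"
  where "cone_on I = {(\<Sum>i\<in>I. c i *\<^sub>R A i) | c. \<forall>i. c i \<ge> (0::real)}"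

lemma convex_cone_on: "convex (cone_on I)"
  unfolding convex_alt
proof (intro ballI allI impI)
  fix x y :: "real ^ 'n" and u :: real
  assume "x \<in> cone_on I" "y \<in> cone_on I" and u: "0 \<le> u \<and> u \<le> 1"
  then obtain c d where c: "x = (\<Sum>i\<in>I. c i *\<^sub>R A i)" "\<forall>i. c i \<ge> 0"
    and d: "y = (\<Sum>i\<in>I. d i *\<^sub>R A i)" "\<forall>i. d i \<ge> 0"
    by (auto simp: cone_on_def)
  have "(1 - u) *\<^sub>R x + u *\<^sub>R y = (\<Sum>i\<in>I. ((1 - u) * c i + u * d i) *\<^sub>R A i)"
    by (simp add: c d scaleR_sum_right sum.distrib scaleR_add_left)
  moreover have "\<forall>i. (1 - u) * c i + u * d i \<ge> 0" using c d u by simp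
  ultimately show "(1 - u) *\<^sub>R x + u *\<^sub>R y \<in> cone_on I"
    unfolding cone_on_def mem_Collect_eq
    by (intro exI[of _ "\<lambda>i. (1 - u) * c i + u * d i"] conjI)
qed

lemma sum_cone_on: "\<forall>i. c i \<ge> 0 \<Longrightarrow> (\<Sum>i\<in>I. c i *\<^sub>R A i) \<in> cone_on I"
  by (auto simp: cone_on_def)

definition ray :: "'m \<Rightarrow> (real ^ 'n) set"
  where "ray i = {t *\<^sub>R A i | t. t \<ge> (0::real)}"

lemma aff_dim_ray: "aff_dim (ray i) = 1"
proof -
  have "0 \<in> ray i" unfolding ray_def mem_Collect_eq by (intro exI[of _ 0]) simp
  moreover have "A i \<in> ray i" unfolding ray_def mem_Collect_eq by (intro exI[of _ 1]) simp
  ultimately have "{0, A i} \<subseteq> ray i" by simp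
  moreover have "ray i \<subseteq> affine hull {0, A i}"
    unfolding ray_def affine_hull_2
  proof safe
    fix t :: real
    show "\<exists>u v. t *\<^sub>R A i = u *\<^sub>R 0 + v *\<^sub>R A i \<and> u + v = 1"
      by (intro exI[of _ "1 - t"] exI[of _ t]) simp
  qed
  ultimately have "aff_dim (ray i) = aff_dim {0, A i}"
    by (metis aff_dim_affine_hull aff_dim_subset antisym)
  then show ?thesis using A_nonzero[of i] by simp
qed

text \<open>The sum \<open>h\<close> of the other dual vectors is 0 on \<open>A i\<close> and 1 on
  the remaining active normals, so its kernel is a supporting hyperplane that cuts out the
  ray.\<close>

lemma ray_edge_of_cone_on:
  assumes x: "x \<in> P" and i: "i \<in> active x"
  shows "ray i edge_of cone_on (active x)"
proof -
  obtain d where d: "\<And>i j. i \<in> active x \<Longrightarrow> j \<in> active x \<Longrightarrow> A i \<bullet> d j = (if i = j then 1 else 0)"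
    using dual_basis[OF x] by blast
  define h where "h = (\<Sum>j\<in>active x - {i}. d j)"
  have Ah: "A j \<bullet> h = (if j = i then 0 else 1)" if "j \<in> active x" for j
    using that d by (simp add: h_def inner_sum_right)
  have val: "h \<bullet> (\<Sum>j\<in>active x. c j *\<^sub>R A j) = (\<Sum>j\<in>active x - {i}. c j)" for c
  proof -
    have "h \<bullet> (\<Sum>j\<in>active x. c j *\<^sub>R A j) = (\<Sum>j\<in>active x. c j * (if j = i then 0 else 1))"
      by (auto simp: inner_sum_right inner_commute[of h] Ah intro!: sum.cong)
    also have "\<dots> = (\<Sum>j\<in>active x - {i}. c j)"
      using i by (simp add: sum.remove[of "active x" i])
    finally show ?thesis .
  qed
  have "ray i = cone_on (active x) \<inter> {y. h \<bullet> y = 0}"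
  proof (intro set_eqI iffI)
    fix y assume "y \<in> ray i"
    then obtain t where t: "y = t *\<^sub>R A i" "t \<ge> 0" by (auto simp: ray_def)
    define c where "c = (\<lambda>j. if j = i then t else 0)"
    have y: "y = (\<Sum>j\<in>active x. c j *\<^sub>R A j)"
      using i t by (simp add: c_def if_distrib[of "\<lambda>r. r *\<^sub>R _"] cong: if_cong)
    moreover have "\<forall>j. 0 \<le> c j" using t by (simp add: c_def)
    ultimately show "y \<in> cone_on (active x) \<inter> {y. h \<bullet> y = 0}"
      using sum_cone_on[of c "active x"] by (simp add: val) (simp add: c_def)
  next
    fix y assume "y \<in> cone_on (active x) \<inter> {y. h \<bullet> y = 0}"
    then obtain c where c: "y = (\<Sum>j\<in>active x. c j *\<^sub>R A j)" "\<forall>j. c j \<ge> 0" "h \<bullet> y = 0"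
      by (auto simp: cone_on_def)
    then have "(\<Sum>j\<in>active x - {i}. c j) = 0" using val by simp
    then have "\<forall>j\<in>active x - {i}. c j = 0"
      using c(2) by (subst (asm) sum_nonneg_eq_0_iff) auto
    then have "y = c i *\<^sub>R A i" using i c(1) by (simp add: sum.remove[of "active x" i])
    then show "y \<in> ray i" using c(2) by (auto simp: ray_def)
  qed
  moreover have "0 \<le> h \<bullet> y" if "y \<in> cone_on (active x)" for y
    using that by (auto simp: cone_on_def val intro!: sum_nonneg)
  ultimately have "ray i face_of cone_on (active x)"
    using face_of_Int_supporting_hyperplane_ge[OF convex_cone_on, of "active x" 0 h] by simp
  then show ?thesis by (simp add: edge_of_def aff_dim_ray)
qed

text \<open>Write \<open>A i\<close> as the midpoint of \<open>p\<close>, twice one nonzero summand,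
  and \<open>q\<close>, twice the rest. The face property puts \<open>p\<close> on the ray, so some
  normal indexed by \<open>I\<close> is a positive multiple of \<open>A i\<close>.\<close>

lemma edge_of_cone_on_generator:
  assumes e: "ray i edge_of cone_on I"
  shows "i \<in> I"
proof -
  have face: "ray i face_of cone_on I" using e by (simp add: edge_of_def)
  have Ai: "A i \<in> ray i" unfolding ray_def mem_Collect_eq by (intro exI[of _ 1]) simp
  then have "A i \<in> cone_on I" using face face_of_imp_subset by blast
  then obtain c where c: "A i = (\<Sum>j\<in>I. c j *\<^sub>R A j)" "\<forall>j. c j \<ge> 0"
    by (auto simp: cone_on_def)
  have "\<exists>j\<in>I. c j \<noteq> 0" using A_nonzero[of i] c(1) by (metis (no_types, lifting) scaleR_zero_left sum.neutral)
  then obtain j where j: "j \<in> I" "c j > 0" using c(2) by (metis less_eq_real_def)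
  define p where "p = (2 * c j) *\<^sub>R A j"
  define q where "q = 2 *\<^sub>R (\<Sum>k\<in>I - {j}. c k *\<^sub>R A k)"
  have mid: "midpoint p q = A i"
    using j(1) by (simp add: c(1) p_def q_def midpoint_def scaleR_add_right sum.remove[of I j])
  have "p \<in> cone_on I"
  proof -
    have "p = (\<Sum>k\<in>I. (if k = j then 2 * c j else 0) *\<^sub>R A k)"
      using j(1) by (simp add: p_def if_distrib[of "\<lambda>r. r *\<^sub>R _"] cong: if_cong)
    then show ?thesis using c(2) sum_cone_on[of "\<lambda>k. if k = j then 2 * c j else 0" I] by simp
  qed
  moreover have "q \<in> cone_on I"
  proof -
    have "q = (\<Sum>k\<in>I. (if k = j then 0 else 2 * c k) *\<^sub>R A k)"
      using j(1) by (simp add: q_def sum.remove[of I j] scaleR_sum_right)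
    then show ?thesis using c(2) sum_cone_on[of "\<lambda>k. if k = j then 0 else 2 * c k" I] by simp
  qed
  ultimately have "p \<in> ray i"
  proof (cases "p = q")
    case True
    then show ?thesis using mid Ai by simp
  next
    case False
    assume "p \<in> cone_on I" "q \<in> cone_on I"
    then show ?thesis
      using face_ofD[OF face, of "A i" p q] False mid Ai by (metis midpoint_in_open_segment)
  qed
  then obtain t where t: "(2 * c j) *\<^sub>R A j = t *\<^sub>R A i" "t \<ge> 0" by (auto simp: ray_def p_def)
  define s where "s = t / (2 * c j)"
  have Aj: "A j = s *\<^sub>R A i"
  proof -
    have "A j = (1 / (2 * c j)) *\<^sub>R ((2 * c j) *\<^sub>R A j)" using j(2) by simp
    also have "\<dots> = s *\<^sub>R A i" unfolding t(1) s_def by simp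
    finally show ?thesis .
  qed
  then have "s \<noteq> 0" using A_nonzero[of j] by auto
  then have "0 < s" using t(2) j(2) by (simp add: s_def)
  then show ?thesis using A_parallel_eq[OF Aj] j(1) by simp
qed

text \<open>Recovers the index set from the bare cone, so that g-subsets become subsets of active
  sets.\<close>

lemma gens_cone_on: "x \<in> P \<Longrightarrow> gens a (cone_on (active x)) = active x"
  using ray_edge_of_cone_on edge_of_cone_on_generator
  unfolding gens_def ray_def by blast

text \<open>A face is represented by a relative interior point: a facet contains the face iff it
  contains that point. Conversely, \<open>x\<close> represents the face
  \<open>face_on (active x)\<close>.\<close>

lemma normal_fan_eq: "normal_fan a b = {cone_on (active x) | x. x \<in> P}"
proof (intro set_eqI iffI)
  fix \<sigma> assume "\<sigma> \<in> normal_fan a b"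
  then obtain Q where Q: "Q face_of P" "Q \<noteq> {}" "\<sigma> = sigma_cone a b Q"
    by (auto simp: normal_fan_def)
  obtain x where x: "x \<in> rel_interior Q"
    using Q face_of_imp_convex rel_interior_eq_empty by blast
  then have xQ: "x \<in> Q" using rel_interior_subset by blast
  then have xP: "x \<in> P" using Q face_of_imp_subset by blast
  have "Q \<subseteq> facetP a b i \<longleftrightarrow> i \<in> active x" for i
    using subset_of_face_of[OF facetP_face[of i] face_of_imp_subset[OF Q(1)]] x xQ xP
    by (auto simp: facetP_eq)
  then have "\<sigma> = cone_on (active x)" by (simp add: Q(3) sigma_cone_def cone_on_def)
  then show "\<sigma> \<in> {cone_on (active x) | x. x \<in> P}" using xP by blast
next
  fix \<sigma> assume "\<sigma> \<in> {cone_on (active x) | x. x \<in> P}"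
  then obtain x where x: "x \<in> P" "\<sigma> = cone_on (active x)" by blast
  have mem: "x \<in> face_on (active x)" using x by (simp add: face_on_def)
  then have "face_on (active x) \<subseteq> facetP a b i \<longleftrightarrow> i \<in> active x" for i
    by (auto simp: face_on_def facetP_eq)
  then have "\<sigma> = sigma_cone a b (face_on (active x))"
    by (simp add: x(2) sigma_cone_def cone_on_def)
  then show "\<sigma> \<in> normal_fan a b" using face_on_face mem by (auto simp: normal_fan_def)
qed

section \<open>The spaces in terms of active sets\<close>

lemma Z_fan_iff:
  "w \<in> Z_fan a (normal_fan a b) \<longleftrightarrow>
    (\<exists>x\<in>P. \<forall>j. cmod (w $ j) \<le> 1 \<and> (j \<notin> active x \<longrightarrow> cmod (w $ j) = 1))"
proof -
  have "w \<in> Z_fan a (normal_fan a b) \<longleftrightarrow> (\<exists>x\<in>P. (\<forall>j. cmod (w $ j) \<le> 1) \<and>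
      (\<forall>j. j \<notin> gens a (cone_on (active x)) \<longrightarrow> cmod (w $ j) = 1))"
    unfolding Z_fan_def normal_fan_eq by blast
  then show ?thesis by (simp add: gens_cone_on all_conj_distrib cong: bex_cong)
qed

lemma Z_poly_iff: "z \<in> Z_poly a b \<longleftrightarrow> (\<exists>x\<in>P. \<forall>i. (cmod (z $ i))\<^sup>2 = slack x i)"
  by (auto simp: Z_poly_def rho_def iP_def slack_def vec_eq_iff image_iff)

lemma Z_poly_subset_U_fan: "Z_poly a b \<subseteq> U_fan a (normal_fan a b)"
proof
  fix z assume "z \<in> Z_poly a b"
  then obtain x where x: "x \<in> P" "\<And>i. (cmod (z $ i))\<^sup>2 = slack x i" by (auto simp: Z_poly_iff)
  have "g_subset a (normal_fan a b) I" if "\<forall>i\<in>I. z $ i = 0" for I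
  proof -
    have "i \<in> active x" if "i \<in> I" for i
      using x(2)[of i] \<open>\<forall>i\<in>I. z $ i = 0\<close> that by (simp add: active_def)
    then have "I \<subseteq> gens a (cone_on (active x))" using gens_cone_on[OF x(1)] by blast
    then show ?thesis using x(1) by (auto simp: g_subset_def normal_fan_eq)
  qed
  then show "z \<in> U_fan a (normal_fan a b)" by (auto simp: U_fan_def)
qed

end

subsection \<open>Logarithms\<close>

text \<open>The left side is the tangent line of s ln s at \<open>m\<close>. At \<open>s = 0\<close>
  the product vanishes, which is also the correct limit.\<close>

lemma mult_ln_tangent:
  fixes s m :: real
  assumes "0 \<le> s" "0 < m"
  shows "s * ln m + s - m \<le> s * ln s"
proof (cases "s = 0")
  case False
  with assms have s: "0 < s" by simp
  have "ln (m / s) \<le> m / s - 1" using s assms by (intro ln_le_minus_one) simp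
  then have "s * (ln m - ln s) \<le> s * (m / s - 1)"
    using s assms by (intro mult_left_mono) (simp_all add: ln_div)
  also have "s * (m / s - 1) = m - s" using s by (simp add: field_simps)
  finally show ?thesis by (simp add: algebra_simps)
qed (use assms in simp)

text \<open>Weighted sum of the tangent inequalities at the convex combination, which is positive
  because \<open>r\<close> is.\<close>

lemma mult_ln_convex:
  fixes s r t :: real
  assumes "0 \<le> s" "0 < r" "0 < t" "t < 1"
  shows "((1 - t) * s + t * r) * ln ((1 - t) * s + t * r) \<le> (1 - t) * (s * ln s) + t * (r * ln r)"
proof -
  define m where "m = (1 - t) * s + t * r"
  have m: "0 < m" using assms by (simp add: m_def add_nonneg_pos)
  have "(1 - t) * (s * ln m + s - m) \<le> (1 - t) * (s * ln s)"
    using assms m by (intro mult_left_mono mult_ln_tangent) auto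
  moreover have "t * (r * ln m + r - m) \<le> t * (r * ln r)"
    using assms m by (intro mult_left_mono mult_ln_tangent) auto
  moreover have "(1 - t) * (s * ln m + s - m) + t * (r * ln m + r - m) = m * ln m"
    by (simp add: m_def algebra_simps)
  ultimately show ?thesis unfolding m_def by linarith
qed

lemma continuous_on_mult_ln: "continuous_on {0::real..} (\<lambda>s. s * ln s)"
  unfolding continuous_on_def
proof
  fix x :: real assume x: "x \<in> {0..}"
  show "((\<lambda>s. s * ln s) \<longlongrightarrow> x * ln x) (at x within {0..})"
  proof (cases "x = 0")
    case True
    \<comment> \<open>Applying ln y <= y - 1 to y = 1 / sqrt s, not to 1 / s, gives a lower bound
      that tends to 0.\<close>
    have lower: "2 * s - 2 * sqrt s \<le> s * ln s" if "0 \<le> s" for s :: real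
    proof (cases "s = 0")
      case False
      then have s: "0 < s" "sqrt s * sqrt s = s" using that by auto
      have "ln (1 / sqrt s) \<le> 1 / sqrt s - 1" using s by (intro ln_le_minus_one) simp
      then have "1 - 1 / sqrt s \<le> ln s / 2" using s by (simp add: ln_div ln_sqrt)
      then have "2 * s * (1 - 1 / sqrt s) \<le> 2 * s * (ln s / 2)"
        using s by (intro mult_left_mono) auto
      moreover have "2 * s * (1 - 1 / sqrt s) = 2 * s - 2 * (s / sqrt s)"
        by (simp add: right_diff_distrib)
      moreover have "s / sqrt s = sqrt s" using s by (intro real_div_sqrt) simp
      ultimately show ?thesis by simp
    qed simp
    have upper: "s * ln s \<le> s * (s - 1)" if "0 \<le> s" for s :: real
      using that ln_le_minus_one[of s] by (cases "s = 0") (auto intro: mult_left_mono)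
    have l: "((\<lambda>s. 2 * s - 2 * sqrt s) \<longlongrightarrow> 2 * 0 - 2 * sqrt 0) (at 0 within {0::real..})"
      by (intro tendsto_intros)
    have u: "((\<lambda>s. s * (s - 1)) \<longlongrightarrow> 0 * (0 - 1)) (at 0 within {0::real..})"
      by (intro tendsto_intros)
    have ev: "eventually (\<lambda>s. 2 * s - 2 * sqrt s \<le> s * ln s) (at 0 within {0::real..})"
      "eventually (\<lambda>s. s * ln s \<le> s * (s - 1)) (at 0 within {0::real..})"
      unfolding eventually_at_filter
      by (intro always_eventually allI impI lower upper; simp)+
    have "((\<lambda>s. s * ln s) \<longlongrightarrow> 0) (at 0 within {0::real..})"
      using tendsto_sandwich[OF ev] l u by simp
    then show ?thesis using True by simp
  next
    case False
    then show ?thesis by (intro tendsto_intros) auto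
  qed
qed

text \<open>Logarithm and square are both increasing. Requiring common zeros excludes the value
  \<open>ln 0 = 0\<close>, which breaks monotonicity.\<close>

lemma diff_ln_mult_diff_nonpos:
  fixes x y :: real
  assumes "0 \<le> x" "0 \<le> y" "x = 0 \<longleftrightarrow> y = 0"
  shows "(ln x - ln y) * (y\<^sup>2 - x\<^sup>2) \<le> 0" "(ln x - ln y) * (y\<^sup>2 - x\<^sup>2) = 0 \<Longrightarrow> x = y"
proof -
  have "(ln x - ln y) * (y\<^sup>2 - x\<^sup>2) < 0" if "x \<noteq> y"
  proof (cases "x < y")
    case True
    then have "0 < x" using assms by linarith
    then show ?thesis using True assms by (intro mult_neg_pos) (auto intro: power_strict_mono)
  next
    case False
    then have "y < x" "0 < y" using assms that by linarith+
    then show ?thesis using assms by (intro mult_pos_neg) (auto intro: power_strict_mono)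
  qed
  then show "(ln x - ln y) * (y\<^sup>2 - x\<^sup>2) \<le> 0" "(ln x - ln y) * (y\<^sup>2 - x\<^sup>2) = 0 \<Longrightarrow> x = y"
    by force+
qed

subsection \<open>Orbits\<close>

context simple_presentation
begin

abbreviation ZP :: "(complex ^ 'm) set" where "ZP \<equiv> Z_poly a b"

abbreviation ZF :: "(complex ^ 'm) set" where "ZF \<equiv> Z_fan a (normal_fan a b)"

text \<open>The last condition says that the vector \<open>ln \<bar>w\<bar> - ln \<bar>z\<bar>\<close> can be changed on the zero
  coordinates so as to become a linear relation between the \<open>A i\<close>. The junk value \<open>ln 0 = 0\<close> is
  harmless, since \<open>A i \<bullet> u = 0\<close> there.\<close>
definition same_orbit :: "complex ^ 'm \<Rightarrow> complex ^ 'm \<Rightarrow> bool"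
  where "same_orbit z w \<longleftrightarrow>
    (\<forall>i. z $ i = 0 \<longleftrightarrow> w $ i = 0) \<and>
    (\<forall>i. cmod (z $ i) *\<^sub>R w $ i = cmod (w $ i) *\<^sub>R z $ i) \<and>
    (\<forall>u. (\<forall>i. z $ i = 0 \<longrightarrow> A i \<bullet> u = 0) \<longrightarrow>
      (\<Sum>i\<in>UNIV. (ln (cmod (w $ i)) - ln (cmod (z $ i))) * (A i \<bullet> u)) = 0)"

lemma Z_poly_point:
  assumes "z \<in> ZP"
  obtains x where "x \<in> P" "\<And>i. (cmod (z $ i))\<^sup>2 = slack x i" "active x = {i. z $ i = 0}"
proof -
  obtain x where x: "x \<in> P" "\<And>i. (cmod (z $ i))\<^sup>2 = slack x i"
    using assms by (auto simp: Z_poly_iff)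
  then have "active x = {i. z $ i = 0}" unfolding active_def by (simp flip: x(2))
  then show thesis using that x by blast
qed

lemma Z_fan_point:
  assumes "w \<in> ZF"
  obtains x where "x \<in> P" "\<And>i. cmod (w $ i) \<le> 1" "\<And>i. i \<notin> active x \<Longrightarrow> cmod (w $ i) = 1"
    "{i. w $ i = 0} \<subseteq> active x"
proof -
  obtain x where x: "x \<in> P" "\<And>i. cmod (w $ i) \<le> 1" "\<And>i. i \<notin> active x \<Longrightarrow> cmod (w $ i) = 1"
    using assms by (auto simp: Z_fan_iff)
  then have "{i. w $ i = 0} \<subseteq> active x" by force
  then show thesis using that x by blast
qed

text \<open>A coordinate of \<open>w\<close> indexed by an active facet may be nonzero; such facets
  are left by \<open>active_subset_realized\<close>.\<close>

lemma Z_fan_zero_set: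
  assumes "w \<in> ZF"
  obtains x where "x \<in> P" "active x = {i. w $ i = 0}"
  using Z_fan_point[OF assms] active_subset_realized by metis

text \<open>The point of \<open>ZF\<close> in the orbit of \<open>z\<close> is found by maximising a linear functional \<open>v\<close>
  on a face: in the basis of active normals at a maximiser, \<open>v\<close> has nonpositive coefficients,
  which are the logarithms of the moduli.\<close>
lemma Z_fan_orbit_exists:
  assumes z: "z \<in> ZP"
  shows "\<exists>w\<in>ZF. same_orbit z w"
proof -
  obtain x where x: "x \<in> P" and I: "active x = {i. z $ i = 0}" using Z_poly_point[OF z] by metis
  \<comment> \<open>The convention \<open>ln 0 = 0\<close> drops the vanishing coordinates; their
    normals are constant on the face anyway.\<close>
  define v where "v = (\<Sum>i\<in>UNIV. ln (cmod (z $ i)) *\<^sub>R A i)"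
  have "face_on (active x) \<noteq> {}" using x by (auto simp: face_on_def)
  then obtain y where y: "y \<in> face_on (active x)" "\<And>y'. y' \<in> face_on (active x) \<Longrightarrow> v \<bullet> y' \<le> v \<bullet> y"
    using continuous_attains_sup[OF face_on_compact _ continuous_on_inner[OF continuous_on_const continuous_on_id]]
    by blast
  then have yP: "y \<in> P" and sub: "active x \<subseteq> active y" by (auto simp: face_on_def)
  obtain d where d: "\<And>i j. i \<in> active y \<Longrightarrow> j \<in> active y \<Longrightarrow> A i \<bullet> d j = (if i = j then 1 else 0)"
    using dual_basis[OF yP] by blast
  \<comment> \<open>Coefficients of \<open>v\<close> in the active normals at \<open>y\<close>,
    modulo those active at \<open>x\<close>, where \<open>w\<close> will vanish.\<close>
  define l where "l i = (if i \<in> active y - active x then v \<bullet> d i else 0)" for i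
  have feasible: "v \<bullet> u \<le> 0" if u: "\<And>i. i \<in> active y \<Longrightarrow> 0 \<le> A i \<bullet> u"
    and u0: "\<And>i. i \<in> active x \<Longrightarrow> A i \<bullet> u = 0" for u
  proof -
    obtain e where e: "0 < e" "\<And>t. 0 \<le> t \<Longrightarrow> t \<le> e \<Longrightarrow> y + t *\<^sub>R u \<in> P"
      using feasible_direction[OF yP u] by metis
    have "active x \<subseteq> active (y + e *\<^sub>R u)"
      using sub u0 by (force simp: active_def slack_add)
    then have "y + e *\<^sub>R u \<in> face_on (active x)" using e by (simp add: face_on_def)
    then have "v \<bullet> (y + e *\<^sub>R u) \<le> v \<bullet> y" by (rule y(2))
    then show ?thesis using e(1) by (simp add: inner_add_right mult_le_0_iff)
  qed
  have l_nonpos: "l i \<le> 0" for i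
  proof (cases "i \<in> active y - active x")
    case True
    have "v \<bullet> d i \<le> 0"
    proof (rule feasible)
      show "0 \<le> A j \<bullet> d i" if "j \<in> active y" for j using d[OF that, of i] True by simp
      show "A j \<bullet> d i = 0" if "j \<in> active x" for j using d[of j i] sub that True by auto
    qed
    then show ?thesis by (simp add: l_def)
  qed (auto simp: l_def)
  \<comment> \<open>\<open>sgn\<close> carries the phase of \<open>z\<close>, and
    \<open>sgn 0 = 0\<close> keeps its zeros.\<close>
  define w where "w = (\<chi> i. exp (l i) *\<^sub>R sgn (z $ i))"
  have cmod_w: "cmod (w $ i) = (if z $ i = 0 then 0 else exp (l i))" for i
    by (simp add: w_def norm_sgn)
  have "w \<in> ZF"
    unfolding Z_fan_iff
  proof (intro bexI[OF _ yP] allI conjI impI)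
    fix j
    show "cmod (w $ j) \<le> 1" using l_nonpos by (simp add: cmod_w)
    assume j: "j \<notin> active y"
    then have "z $ j \<noteq> 0" using sub I by auto
    then show "cmod (w $ j) = 1" using j by (simp add: cmod_w l_def)
  qed
  moreover have "same_orbit z w"
    unfolding same_orbit_def
  proof (intro conjI allI impI)
    fix i
    show "z $ i = 0 \<longleftrightarrow> w $ i = 0" by (simp add: w_def sgn_zero_iff)
    show "cmod (z $ i) *\<^sub>R w $ i = cmod (w $ i) *\<^sub>R z $ i"
      by (simp add: cmod_w) (simp add: w_def sgn_div_norm)
  next
    fix u assume u: "\<forall>i. z $ i = 0 \<longrightarrow> A i \<bullet> u = 0"
    \<comment> \<open>The part of \<open>u\<close> killed by all active normals at \<open>y\<close>.
      Both \<open>u'\<close> and its negative are feasible, so optimality gives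
      \<open>v \<bullet> u' = 0\<close>.\<close>
    define u' where "u' = u - (\<Sum>j\<in>active y. (A j \<bullet> u) *\<^sub>R d j)"
    have u': "A i \<bullet> u' = 0" if "i \<in> active y" for i
    proof -
      have "(\<Sum>j\<in>active y. (A j \<bullet> u) * (A i \<bullet> d j)) = (\<Sum>j\<in>active y. if i = j then A j \<bullet> u else 0)"
        using d that by (intro sum.cong) auto
      then show ?thesis using that by (simp add: u'_def inner_diff_right inner_sum_right)
    qed
    have "v \<bullet> u' \<le> 0" using u' sub by (intro feasible) auto
    moreover have "v \<bullet> (- u') \<le> 0" using u' sub by (intro feasible) auto
    ultimately have "v \<bullet> u' = 0" by simp
    then have "v \<bullet> u = (\<Sum>j\<in>active y. (A j \<bullet> u) * (v \<bullet> d j))"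
      by (simp add: u'_def inner_diff_right inner_sum_right)
    also have "\<dots> = (\<Sum>j\<in>active y. l j * (A j \<bullet> u))"
      using u I by (intro sum.cong) (auto simp: l_def)
    also have "\<dots> = (\<Sum>j\<in>UNIV. l j * (A j \<bullet> u))"
      by (intro sum.mono_neutral_left) (auto simp: l_def)
    finally have vu: "v \<bullet> u = (\<Sum>j\<in>UNIV. l j * (A j \<bullet> u))" .
    have "(\<Sum>i\<in>UNIV. (ln (cmod (w $ i)) - ln (cmod (z $ i))) * (A i \<bullet> u))
        = (\<Sum>i\<in>UNIV. l i * (A i \<bullet> u) - ln (cmod (z $ i)) * (A i \<bullet> u))"
      using u by (intro sum.cong) (auto simp: cmod_w algebra_simps)
    also have "\<dots> = 0"
      by (simp add: sum_subtractf flip: vu) (simp add: v_def inner_sum_left)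
    finally show "(\<Sum>i\<in>UNIV. (ln (cmod (w $ i)) - ln (cmod (z $ i))) * (A i \<bullet> u)) = 0" .
  qed
  ultimately show ?thesis ..
qed

text \<open>Complementary slackness: pairing the difference of logarithms with \<open>x - x'\<close>
  shows that \<open>l'\<close>, like \<open>l\<close>, is supported on \<open>active x\<close>. The
  dual basis at \<open>x\<close> then compares coefficients.\<close>

lemma Z_fan_orbit_unique:
  assumes w: "w \<in> ZF" "same_orbit z w" and w': "w' \<in> ZF" "same_orbit z w'"
  shows "w = w'"
proof -
  obtain x where x: "x \<in> P" "\<And>i. cmod (w $ i) \<le> 1" "\<And>i. i \<notin> active x \<Longrightarrow> cmod (w $ i) = 1"
    "{i. w $ i = 0} \<subseteq> active x" using Z_fan_point[OF w(1)] by blast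
  obtain x' where x': "x' \<in> P" "\<And>i. cmod (w' $ i) \<le> 1" "\<And>i. i \<notin> active x' \<Longrightarrow> cmod (w' $ i) = 1"
    "{i. w' $ i = 0} \<subseteq> active x'" using Z_fan_point[OF w'(1)] by blast
  define l where "l i = ln (cmod (w $ i))" for i
  define l' where "l' i = ln (cmod (w' $ i))" for i
  have zero: "z $ i = 0 \<longleftrightarrow> w $ i = 0" "z $ i = 0 \<longleftrightarrow> w' $ i = 0" for i
    using w(2) w'(2) by (auto simp: same_orbit_def)
  have nonpos: "l i \<le> 0" "l' i \<le> 0" for i
    using x(2)[of i] x'(2)[of i]
    by (cases "w $ i = 0"; cases "w' $ i = 0"; simp add: l_def l'_def)+
  have off: "i \<notin> active x \<Longrightarrow> l i = 0" "i \<notin> active x' \<Longrightarrow> l' i = 0" for i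
    using x(3)[of i] x'(3)[of i] by (simp_all add: l_def l'_def)
  have diff: "(\<Sum>i\<in>UNIV. (l i - l' i) * (A i \<bullet> u)) = 0"
    if u: "\<And>i. z $ i = 0 \<Longrightarrow> A i \<bullet> u = 0" for u
  proof -
    have "(\<Sum>i\<in>UNIV. (l i - ln (cmod (z $ i))) * (A i \<bullet> u)) = 0"
      "(\<Sum>i\<in>UNIV. (l' i - ln (cmod (z $ i))) * (A i \<bullet> u)) = 0"
      using w(2) w'(2) u by (auto simp: same_orbit_def l_def l'_def)
    then show ?thesis by (simp add: left_diff_distrib sum_subtractf)
  qed
  have "A i \<bullet> (x - x') = 0" if "z $ i = 0" for i
  proof -
    have "i \<in> active x" "i \<in> active x'" using x(4) x'(4) zero[of i] that by auto
    then show ?thesis by (simp add: active_def flip: slack_diff)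
  qed
  from diff[OF this] have "(\<Sum>i\<in>UNIV. (l i - l' i) * (slack x i - slack x' i)) = 0"
    by (simp add: slack_diff)
  \<comment> \<open>\<open>l\<close> lives where the slack of \<open>x\<close> is zero, and
    \<open>l'\<close> where that of \<open>x'\<close> is, so only the mixed products
    survive.\<close>
  moreover have "(l i - l' i) * (slack x i - slack x' i) = (- l i) * slack x' i + (- l' i) * slack x i" for i
    using off[of i] by (cases "i \<in> active x"; cases "i \<in> active x'") (auto simp: active_def algebra_simps)
  ultimately have sum0: "(\<Sum>i\<in>UNIV. (- l i) * slack x' i + (- l' i) * slack x i) = 0"
    by (simp only:)
  have nn: "0 \<le> (- l i) * slack x' i" "0 \<le> (- l' i) * slack x i" for i
    using nonpos[of i] x(1) x'(1) by (simp_all add: mem_P mult_nonpos_nonneg)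
  have each: "(- l i) * slack x' i + (- l' i) * slack x i = 0" for i
    using sum0 by (subst (asm) sum_nonneg_eq_0_iff) (use add_nonneg_nonneg[OF nn] in auto)
  have l'0: "l' i = 0" if "i \<notin> active x" for i
  proof -
    have "l' i * slack x i = 0" using each[of i] nn[of i] by linarith
    then show ?thesis using that by (simp add: active_def)
  qed
  obtain d where d: "\<And>i j. i \<in> active x \<Longrightarrow> j \<in> active x \<Longrightarrow> A i \<bullet> d j = (if i = j then 1 else 0)"
    using dual_basis[OF x(1)] by blast
  have eq: "l j = l' j" if j: "z $ j \<noteq> 0" for j
  proof (cases "j \<in> active x")
    case True
    have "A i \<bullet> d j = 0" if "z $ i = 0" for i
    proof -
      have "i \<in> active x" using x(4) zero[of i] that by auto
      then show ?thesis using d[OF _ True, of i] that j by auto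
    qed
    from diff[OF this] have "0 = (\<Sum>i\<in>UNIV. (l i - l' i) * (A i \<bullet> d j))" by simp
    also have "\<dots> = (\<Sum>i\<in>UNIV. if i = j then l i - l' i else 0)"
    proof (intro sum.cong refl)
      fix i
      show "(l i - l' i) * (A i \<bullet> d j) = (if i = j then l i - l' i else 0)"
        using d[OF _ True, of i] off(1)[of i] l'0[of i] True by (cases "i \<in> active x") auto
    qed
    finally show ?thesis by simp
  next
    case False
    then show ?thesis using off(1) l'0 by simp
  qed
  show ?thesis
    unfolding vec_eq_iff
  proof
    fix i
    show "w $ i = w' $ i"
    proof (cases "z $ i = 0")
      case True
      then show ?thesis using zero[of i] by simp
    next
      case False
      have "cmod (w $ i) = cmod (w' $ i)"
        using eq[OF False] False zero[of i] by (simp add: l_def l'_def)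
      moreover have "cmod (z $ i) *\<^sub>R w $ i = cmod (w $ i) *\<^sub>R z $ i"
        "cmod (z $ i) *\<^sub>R w' $ i = cmod (w' $ i) *\<^sub>R z $ i"
        using w(2) w'(2) by (auto simp: same_orbit_def)
      ultimately have "cmod (z $ i) *\<^sub>R w $ i = cmod (z $ i) *\<^sub>R w' $ i" by simp
      then show ?thesis using False by simp
    qed
  qed
qed

text \<open>The test direction \<open>x' - x\<close> turns \<open>A i \<bullet> u\<close> into the
  difference of the squared moduli; subtracting the two orbit equations removes \<open>w\<close> and
  leaves terms of one sign.\<close>

lemma Z_poly_orbit_unique:
  assumes z: "z \<in> ZP" "same_orbit z w" and z': "z' \<in> ZP" "same_orbit z' w"
  shows "z = z'"
proof -
  obtain x where x: "x \<in> P" "\<And>i. (cmod (z $ i))\<^sup>2 = slack x i" "active x = {i. z $ i = 0}"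
    using Z_poly_point[OF z(1)] by blast
  obtain x' where x': "x' \<in> P" "\<And>i. (cmod (z' $ i))\<^sup>2 = slack x' i" "active x' = {i. z' $ i = 0}"
    using Z_poly_point[OF z'(1)] by blast
  have zero: "z $ i = 0 \<longleftrightarrow> w $ i = 0" "z' $ i = 0 \<longleftrightarrow> w $ i = 0" for i
    using z(2) z'(2) by (auto simp: same_orbit_def)
  have u: "A i \<bullet> (x' - x) = 0" if "w $ i = 0" for i
    using x(2)[of i] x'(2)[of i] zero[of i] that by (simp flip: slack_diff)
  define l where "l i = ln (cmod (w $ i))" for i
  let ?q = "\<lambda>i. (cmod (z' $ i))\<^sup>2 - (cmod (z $ i))\<^sup>2"
  have "(\<Sum>i\<in>UNIV. (l i - ln (cmod (z $ i))) * ?q i) = 0"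
    "(\<Sum>i\<in>UNIV. (l i - ln (cmod (z' $ i))) * ?q i) = 0"
    using z(2) z'(2) u zero by (auto simp: same_orbit_def l_def x(2) x'(2) slack_diff)
  then have "(\<Sum>i\<in>UNIV. (l i - ln (cmod (z' $ i))) * ?q i - (l i - ln (cmod (z $ i))) * ?q i) = 0"
    unfolding sum_subtractf by simp
  then have "(\<Sum>i\<in>UNIV. (ln (cmod (z $ i)) - ln (cmod (z' $ i))) * ?q i) = 0"
    by (simp add: left_diff_distrib)
  then have sum0: "(\<Sum>i\<in>UNIV. - ((ln (cmod (z $ i)) - ln (cmod (z' $ i))) * ?q i)) = 0"
    unfolding sum_negf by simp
  have norm_eq: "cmod (z $ i) = cmod (z' $ i)" for i
  proof -
    have nn: "(ln (cmod (z $ i)) - ln (cmod (z' $ i))) * ?q i \<le> 0" for i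
      using zero[of i] by (intro diff_ln_mult_diff_nonpos(1)) auto
    have "- ((ln (cmod (z $ i)) - ln (cmod (z' $ i))) * ?q i) = 0"
      using sum0 nn by (subst (asm) sum_nonneg_eq_0_iff) auto
    then have "(ln (cmod (z $ i)) - ln (cmod (z' $ i))) * ?q i = 0" by simp
    moreover have "cmod (z $ i) = 0 \<longleftrightarrow> cmod (z' $ i) = 0" using zero[of i] by simp
    ultimately show ?thesis using diff_ln_mult_diff_nonpos(2) norm_ge_zero by metis
  qed
  show ?thesis
    unfolding vec_eq_iff
  proof
    fix i
    show "z $ i = z' $ i"
    proof (cases "w $ i = 0")
      case True
      then show ?thesis using zero[of i] by simp
    next
      case False
      have "cmod (w $ i) *\<^sub>R z $ i = cmod (w $ i) *\<^sub>R z' $ i"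
        using z(2) z'(2) norm_eq[of i] unfolding same_orbit_def by metis
      then show ?thesis using False by simp
    qed
  qed
qed

text \<open>The point of \<open>ZP\<close> in the orbit of \<open>w\<close> comes from the minimiser of a relative entropy on
  a face.  The minimiser lies in the relative interior, since the slope of \<open>s \<mapsto> s * ln s\<close> at
  \<open>0\<close> is \<open>-\<infinity>\<close>.\<close>
lemma entropy_critical_point:
  assumes y: "y \<in> P"
  obtains x where "x \<in> P" "active x = active y"
    "\<And>u. (\<And>i. i \<in> active y \<Longrightarrow> A i \<bullet> u = 0) \<Longrightarrow>
      (\<Sum>i\<in>- active y. (ln (slack x i) - q i) * (A i \<bullet> u)) = 0"
proof -
  \<comment> \<open>The term \<open>- s\<close> cancels the 1 from the product rule, so the
    derivative in \<open>s\<close> is \<open>ln s - q i\<close>.\<close>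
  define \<psi> where "\<psi> i s = s * ln s - s - q i * s" for i s
  define \<Phi> where "\<Phi> x = (\<Sum>i\<in>- active y. \<psi> i (slack x i))" for x
  have "continuous_on P (\<lambda>x. slack x i * ln (slack x i))" for i
    by (rule continuous_on_compose2[OF continuous_on_mult_ln continuous_on_slack[of P i]])
       (auto simp: mem_P)
  then have "continuous_on P \<Phi>"
    unfolding \<Phi>_def \<psi>_def
    by (intro continuous_on_sum continuous_on_diff continuous_on_mult_left continuous_on_slack)
  then have "continuous_on (face_on (active y)) \<Phi>"
    by (rule continuous_on_subset) (auto simp: face_on_def)
  moreover have y_face: "y \<in> face_on (active y)" using y by (simp add: face_on_def)
  ultimately obtain x where x: "x \<in> face_on (active y)"
    and min: "\<And>x'. x' \<in> face_on (active y) \<Longrightarrow> \<Phi> x \<le> \<Phi> x'"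
    using continuous_attains_inf[OF face_on_compact, of "active y" \<Phi>] by blast
  have xP: "x \<in> P" and sub: "active y \<subseteq> active x" using x by (auto simp: face_on_def)
  have act: "active x = active y"
  proof (rule ccontr)
    assume "active x \<noteq> active y"
    then obtain k where k: "k \<in> active x" "k \<notin> active y" using sub by blast
    have rk: "0 < slack y k" using active_nonactive_pos[OF y k(2)] .
    \<comment> \<open>\<open>C\<close> exceeds any increase of the convex bound from
      \<open>x\<close> to \<open>y\<close>; \<open>t\<close> is chosen so that the logarithmic gain
      at \<open>k\<close>, where the slack of \<open>x\<close> is 0, is exactly
      \<open>- C\<close>.\<close>
    define C where "C = \<bar>\<Phi> y - \<Phi> x\<bar> + 1"
    define t where "t = exp (- C / slack y k)"
    have "- C / slack y k < 0" using rk by (intro divide_neg_pos) (simp_all add: C_def)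
    then have t: "0 < t" "t < 1" by (simp_all add: t_def)
    have tln: "slack y k * ln t = - C" using rk by (simp add: t_def)
    let ?x = "(1 - t) *\<^sub>R x + t *\<^sub>R y"
    have step: "\<psi> i (slack ?x i) \<le> (1 - t) * \<psi> i (slack x i) + t * \<psi> i (slack y i)
        + (if i = k then t * (slack y k * ln t) else 0)" if i: "i \<in> - active y" for i
    proof (cases "i = k")
      case True
      have "slack x k = 0" using k(1) by (simp add: active_def)
      then show ?thesis
        using True t rk unfolding slack_convex_comb \<psi>_def by (simp add: ln_mult algebra_simps)
    next
      case False
      have "0 \<le> slack x i" "0 < slack y i"
        using xP i active_nonactive_pos[OF y] by (auto simp: mem_P)
      from mult_ln_convex[OF this t] False show ?thesis
        unfolding slack_convex_comb \<psi>_def by (simp add: algebra_simps)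
    qed
    have "\<Phi> ?x \<le> (\<Sum>i\<in>- active y. (1 - t) * \<psi> i (slack x i) + t * \<psi> i (slack y i)
        + (if i = k then t * (slack y k * ln t) else 0))"
      unfolding \<Phi>_def by (intro sum_mono step)
    also have "\<dots> = (1 - t) * \<Phi> x + t * \<Phi> y + t * (slack y k * ln t)"
      using k(2) by (simp add: \<Phi>_def sum.distrib sum_distrib_left)
    also have "\<dots> = \<Phi> x + t * (\<Phi> y - \<Phi> x - C)" 
      unfolding tln by (simp add: algebra_simps)
    also have "\<dots> < \<Phi> x" using t(1) by (simp add: mult_less_0_iff C_def)
    finally have "\<Phi> ?x < \<Phi> x" .
    moreover have "?x \<in> face_on (active y)"
      using face_of_imp_convex[OF face_on_face, of "active y"] x y_face t
      unfolding convex_alt by simp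
    ultimately show False using min by fastforce
  qed
  show thesis
  proof (rule that[OF xP act])
    fix u assume u: "\<And>i. i \<in> active y \<Longrightarrow> A i \<bullet> u = 0"
    then obtain e where e: "0 < e"
      "\<And>t. \<bar>t\<bar> \<le> e \<Longrightarrow> x + t *\<^sub>R u \<in> P \<and> active (x + t *\<^sub>R u) = active x"
      using feasible_line[OF xP, of u] act by metis
    have pos: "0 < slack x i" if "i \<in> - active y" for i
      using active_nonactive_pos[OF xP] that act by simp
    let ?g = "\<lambda>t. \<Sum>i\<in>- active y. \<psi> i (slack x i + t * (A i \<bullet> u))"
    have "DERIV ?g 0 :> (\<Sum>i\<in>- active y. (ln (slack x i) - q i) * (A i \<bullet> u))"
      unfolding \<psi>_def
      by (auto intro!: derivative_eq_intros sum.cong dest!: pos simp: algebra_simps)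
    then show "(\<Sum>i\<in>- active y. (ln (slack x i) - q i) * (A i \<bullet> u)) = 0"
    proof (rule DERIV_local_min[OF _ e(1)], intro allI impI)
      fix t :: real assume "\<bar>0 - t\<bar> < e"
      then have "x + t *\<^sub>R u \<in> face_on (active y)" using e(2)[of t] act by (simp add: face_on_def)
      from min[OF this] show "?g 0 \<le> ?g t" by (simp add: \<Phi>_def slack_add)
    qed
  qed
qed

text \<open>The slacks are to be squared moduli, hence the weight
  \<open>2 * ln (cmod (w $ i))\<close>: half of the stationarity condition is the orbit
  condition.\<close>

lemma Z_poly_orbit_exists:
  assumes w: "w \<in> ZF"
  shows "\<exists>z\<in>ZP. same_orbit z w"
proof -
  obtain y where y: "y \<in> P" "active y = {i. w $ i = 0}" using Z_fan_zero_set[OF w] by blast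
  obtain x where x: "x \<in> P" "active x = active y"
    and crit: "\<And>u. (\<And>i. i \<in> active y \<Longrightarrow> A i \<bullet> u = 0) \<Longrightarrow>
      (\<Sum>i\<in>- active y. (ln (slack x i) - 2 * ln (cmod (w $ i))) * (A i \<bullet> u)) = 0"
    using entropy_critical_point[OF y(1), of "\<lambda>i. 2 * ln (cmod (w $ i))"] by blast
  have slack0: "slack x i = 0 \<longleftrightarrow> w $ i = 0" for i
    using x(2) y(2) by (auto simp: active_def)
  have slack_nn: "0 \<le> slack x i" for i using x(1) by (simp add: mem_P)
  define z where "z = (\<chi> i. sqrt (slack x i) *\<^sub>R sgn (w $ i))"
  have cmod_z: "cmod (z $ i) = sqrt (slack x i)" for i
    using slack0[of i] slack_nn[of i] by (auto simp: z_def norm_sgn)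
  have "z \<in> ZP"
    unfolding Z_poly_iff using x(1) slack_nn by (intro bexI[of _ x]) (auto simp: cmod_z)
  moreover have "same_orbit z w"
    unfolding same_orbit_def
  proof (intro conjI allI impI)
    fix i
    show zero: "z $ i = 0 \<longleftrightarrow> w $ i = 0"
      using slack0[of i] by (auto simp: z_def sgn_zero_iff)
    show "cmod (z $ i) *\<^sub>R w $ i = cmod (w $ i) *\<^sub>R z $ i"
      by (cases "w $ i = 0") (simp_all add: cmod_z, simp_all add: z_def sgn_div_norm)
  next
    fix u assume "\<forall>i. z $ i = 0 \<longrightarrow> A i \<bullet> u = 0"
    then have u: "A i \<bullet> u = 0" if "i \<in> active y" for i
      using that y(2) by (simp add: z_def)
    have "(\<Sum>i\<in>UNIV. (ln (cmod (w $ i)) - ln (cmod (z $ i))) * (A i \<bullet> u))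
        = (\<Sum>i\<in>- active y. (ln (cmod (w $ i)) - ln (cmod (z $ i))) * (A i \<bullet> u))"
      using u by (intro sum.mono_neutral_right) auto
    also have "\<dots> = (\<Sum>i\<in>- active y. (- 1 / 2) * ((ln (slack x i) - 2 * ln (cmod (w $ i))) * (A i \<bullet> u)))"
    proof (intro sum.cong refl)
      fix i assume "i \<in> - active y"
      then have "0 < slack x i" using slack0[of i] slack_nn[of i] y(2) by force
      then show "(ln (cmod (w $ i)) - ln (cmod (z $ i))) * (A i \<bullet> u)
          = (- 1 / 2) * ((ln (slack x i) - 2 * ln (cmod (w $ i))) * (A i \<bullet> u))"
        by (simp add: cmod_z ln_sqrt algebra_simps)
    qed
    also have "\<dots> = 0" unfolding sum_distrib_left[symmetric] using crit[OF u] by simp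
    finally show "(\<Sum>i\<in>UNIV. (ln (cmod (w $ i)) - ln (cmod (z $ i))) * (A i \<bullet> u)) = 0" .
  qed
  ultimately show ?thesis ..
qed

end

subsection \<open>Compactness and closedness of the orbit relation\<close>

lemma bounded_vec_componentwise:
  fixes S :: "('a::real_normed_vector ^ 'm::finite) set"
  assumes "\<And>z i. z \<in> S \<Longrightarrow> norm (z $ i) \<le> B i"
  shows "bounded S"
proof -
  have "norm z \<le> (\<Sum>i\<in>UNIV. B i)" if "z \<in> S" for z
  proof -
    have "norm z \<le> (\<Sum>i\<in>UNIV. norm (z $ i))"
      unfolding norm_vec_def by (rule L2_set_le_sum) simp
    also have "\<dots> \<le> (\<Sum>i\<in>UNIV. B i)" by (intro sum_mono assms that)
    finally show ?thesis .
  qed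
  then show ?thesis unfolding bounded_iff by blast
qed

text \<open>Power with the convention \<open>0\<^sup>0 = 1\<close>, unlike \<open>powr\<close>; this keeps it continuous in the base
  for every exponent \<open>e \<ge> 0\<close>.\<close>
definition pow0 :: "real \<Rightarrow> real \<Rightarrow> real"
  where "pow0 x e = (if e = 0 then 1 else x powr e)"

lemma pow0_eq_0_iff: "pow0 x e = 0 \<longleftrightarrow> x = 0 \<and> e \<noteq> 0"
  by (simp add: pow0_def)

lemma ln_pow0: "x \<noteq> 0 \<or> e = 0 \<Longrightarrow> ln (pow0 x e) = e * ln x"
  by (auto simp: pow0_def ln_powr)

lemma pow0_nonneg: "0 \<le> pow0 x e"
  by (simp add: pow0_def)

lemma continuous_on_pow0:
  assumes "continuous_on S f" "\<And>x. x \<in> S \<Longrightarrow> 0 \<le> f x" "0 \<le> e"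
  shows "continuous_on S (\<lambda>x. pow0 (f x) e)"
  unfolding pow0_def using assms
  by (cases "e = 0") (auto intro!: continuous_on_powr')

context simple_presentation
begin

lemma compact_Z_poly: "compact ZP"
proof -
  have "closed ZP"
  proof -
    have "compact (iP a b ` P)"
      by (intro compact_continuous_image compact_P) (unfold iP_def, intro continuous_intros)
    moreover have "continuous_on UNIV (rho :: complex ^ 'm \<Rightarrow> _)"
      unfolding rho_def by (intro continuous_intros)
    moreover have "ZP = rho -` (iP a b ` P)" by (auto simp: Z_poly_def)
    ultimately show ?thesis by (metis closed_vimage compact_imp_closed)
  qed
  moreover have "bounded ZP"
  proof -
    have "\<exists>B. \<forall>x\<in>P. slack x i \<le> B" for i
      using compact_continuous_image[OF continuous_on_slack compact_P, of i]
      by (metis (mono_tags, lifting) bdd_above.unfold bounded_imp_bdd_above compact_imp_bounded imageI)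
    then obtain B where B: "\<And>x i. x \<in> P \<Longrightarrow> slack x i \<le> B i" by metis
    show ?thesis
    proof (rule bounded_vec_componentwise)
      fix z i assume "z \<in> ZP"
      then obtain x where "x \<in> P" "(cmod (z $ i))\<^sup>2 = slack x i" by (auto simp: Z_poly_iff)
      then show "cmod (z $ i) \<le> sqrt (B i)" using B[of x i] by (metis real_le_rsqrt)
    qed
  qed
  ultimately show ?thesis by (simp add: compact_eq_bounded_closed)
qed

lemma compact_Z_fan: "compact ZF"
proof -
  \<comment> \<open>Indexing by active sets instead of points of \<open>P\<close> makes the union
    finite.\<close>
  have "ZF = (\<Union>I\<in>active ` P. {w. \<forall>j. cmod (w $ j) \<le> 1 \<and> (j \<notin> I \<longrightarrow> cmod (w $ j) = 1)})"
    by (rule set_eqI) (simp add: Z_fan_iff)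
  moreover have "closed {w :: complex ^ 'm. \<forall>j. cmod (w $ j) \<le> 1 \<and> (j \<notin> I \<longrightarrow> cmod (w $ j) = 1)}" for I
    by (intro closed_Collect_all closed_Collect_conj closed_Collect_imp closed_Collect_le
        closed_Collect_eq continuous_intros) simp
  ultimately have "closed ZF" by (simp only:) (intro closed_UN finite ballI)
  moreover have "bounded ZF"
    by (rule bounded_vec_componentwise[where B="\<lambda>_. 1"]) (auto simp: Z_fan_iff)
  ultimately show ?thesis by (simp add: compact_eq_bounded_closed)
qed

text \<open>Off the zeros, equality after exchanging \<open>p\<close> and \<open>q\<close>
  exponentiates the orbit condition for u = p - q. Splitting the exponent into two nonnegative
  slacks clears denominators.\<close>

definition binomial_side :: "real ^ 'n \<Rightarrow> real ^ 'n \<Rightarrow> complex ^ 'm \<Rightarrow> complex ^ 'm \<Rightarrow> real"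
  where "binomial_side p q z w =
    (\<Prod>i\<in>UNIV. pow0 (cmod (w $ i)) (slack p i) * pow0 (cmod (z $ i)) (slack q i))"

lemma ln_binomial_side:
  assumes zero: "\<And>i. z $ i = 0 \<longleftrightarrow> w $ i = 0"
    and act: "{i. z $ i = 0} \<subseteq> active p" "{i. z $ i = 0} \<subseteq> active q"
  shows "ln (binomial_side p q z w) =
    (\<Sum>i\<in>UNIV. slack p i * ln (cmod (w $ i)) + slack q i * ln (cmod (z $ i)))"
    and "0 < binomial_side p q z w"
proof -
  have ok: "cmod (w $ i) \<noteq> 0 \<or> slack p i = 0" "cmod (z $ i) \<noteq> 0 \<or> slack q i = 0" for i
    using zero[of i] act by (auto simp: active_def)
  then have ne: "pow0 (cmod (w $ i)) (slack p i) \<noteq> 0" "pow0 (cmod (z $ i)) (slack q i) \<noteq> 0" for i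
    by (auto simp: pow0_eq_0_iff)
  then show "ln (binomial_side p q z w) =
      (\<Sum>i\<in>UNIV. slack p i * ln (cmod (w $ i)) + slack q i * ln (cmod (z $ i)))"
    unfolding binomial_side_def
    by (simp add: ln_prod ln_mult ln_pow0[OF ok(1)] ln_pow0[OF ok(2)])
  show "0 < binomial_side p q z w"
    unfolding binomial_side_def by (intro prod_pos) (use ne pow0_nonneg in \<open>auto simp: less_le\<close>)
qed

lemma binomial_side_eq_0_iff:
  "binomial_side p q z w = 0 \<longleftrightarrow>
    \<not> ({i. w $ i = 0} \<subseteq> active p \<and> {i. z $ i = 0} \<subseteq> active q)"
  by (auto simp: binomial_side_def pow0_eq_0_iff active_def)

text \<open>The logarithmic condition defining an orbit degenerates at the coordinate hyperplanes.
  Exponentiated, it becomes a family of binomial equations, one for each pair of points of \<open>P\<close>,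
  which is a closed condition.\<close>
lemma same_orbit_iff_binomial:
  assumes z: "z \<in> ZP" and w: "w \<in> ZF"
  shows "same_orbit z w \<longleftrightarrow>
    (\<forall>i. cmod (z $ i) *\<^sub>R w $ i = cmod (w $ i) *\<^sub>R z $ i) \<and>
    (\<forall>p\<in>P. \<forall>q\<in>P. binomial_side p q z w = binomial_side q p z w)"
    (is "_ \<longleftrightarrow> ?phase \<and> ?binomial")
proof (intro iffI conjI)
  assume orbit: "same_orbit z w"
  then show ?phase by (simp add: same_orbit_def)
  have zero: "z $ i = 0 \<longleftrightarrow> w $ i = 0" for i using orbit by (simp add: same_orbit_def)
  then have sets: "{i. w $ i = 0} = {i. z $ i = 0}" by simp
  show ?binomial
  proof (intro ballI)
    fix p q assume "p \<in> P" "q \<in> P"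
    show "binomial_side p q z w = binomial_side q p z w"
    proof (cases "{i. z $ i = 0} \<subseteq> active p \<and> {i. z $ i = 0} \<subseteq> active q")
      case True
      have "A i \<bullet> (p - q) = 0" if "z $ i = 0" for i
      proof -
        have "i \<in> active p" "i \<in> active q" using True that by blast+
        then show ?thesis by (simp add: active_def flip: slack_diff)
      qed
      then have "(\<Sum>i\<in>UNIV. (ln (cmod (w $ i)) - ln (cmod (z $ i))) * (slack p i - slack q i)) = 0"
        using orbit by (simp add: same_orbit_def slack_diff)
      then have "(\<Sum>i\<in>UNIV. (slack p i * ln (cmod (w $ i)) + slack q i * ln (cmod (z $ i)))
          - (slack q i * ln (cmod (w $ i)) + slack p i * ln (cmod (z $ i)))) = 0"
        by (simp add: algebra_simps)
      then have "ln (binomial_side p q z w) = ln (binomial_side q p z w)"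
        using True zero by (simp add: ln_binomial_side sum_subtractf)
      then show ?thesis using True zero by (simp add: ln_binomial_side(2))
    next
      case False
      then show ?thesis
        using binomial_side_eq_0_iff[of p q z w] binomial_side_eq_0_iff[of q p z w] sets by metis
    qed
  qed
next
  assume *: "?phase \<and> ?binomial"
  obtain q where q: "q \<in> P" "active q = {i. z $ i = 0}" using Z_poly_point[OF z] by metis
  obtain p where p: "p \<in> P" "active p = {i. w $ i = 0}" using Z_fan_zero_set[OF w] by blast
  \<comment> \<open>The left side is nonzero by the choice of \<open>p\<close> and \<open>q\<close>;
    that the right side is nonzero gives both inclusions of zero sets.\<close>
  have "binomial_side p q z w = binomial_side q p z w" using * p(1) q(1) by blast
  then have "{i. w $ i = 0} \<subseteq> {i. z $ i = 0}" "{i. z $ i = 0} \<subseteq> {i. w $ i = 0}"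
    using binomial_side_eq_0_iff[of p q z w] binomial_side_eq_0_iff[of q p z w] p(2) q(2) by simp_all
  then have zero: "z $ i = 0 \<longleftrightarrow> w $ i = 0" for i by blast
  show "same_orbit z w"
    unfolding same_orbit_def
  proof (intro conjI allI impI)
    show "z $ i = 0 \<longleftrightarrow> w $ i = 0" for i by (rule zero)
    show "cmod (z $ i) *\<^sub>R w $ i = cmod (w $ i) *\<^sub>R z $ i" for i using * by blast
    fix u assume u: "\<forall>i. z $ i = 0 \<longrightarrow> A i \<bullet> u = 0"
    then have "A i \<bullet> u = 0" if "i \<in> active q" for i using that q(2) by simp
    then obtain t where t: "0 < t"
      and t': "\<And>t'. \<bar>t'\<bar> \<le> t \<Longrightarrow> q + t' *\<^sub>R u \<in> P \<and> active (q + t' *\<^sub>R u) = active q"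
      using feasible_line[OF q(1)] by metis
    \<comment> \<open>A multiple of \<open>u\<close> becomes a difference of two points of
      \<open>P\<close> with the same active set, to which the binomial equation applies.\<close>
    define p' where "p' = q + t *\<^sub>R u"
    have p': "p' \<in> P" "active p' = active q" using t t'[of t] by (simp_all add: p'_def)
    then have "ln (binomial_side p' q z w) = ln (binomial_side q p' z w)" using * q(1) by metis
    then have "0 = (\<Sum>i\<in>UNIV. (slack p' i * ln (cmod (w $ i)) + slack q i * ln (cmod (z $ i)))
          - (slack q i * ln (cmod (w $ i)) + slack p' i * ln (cmod (z $ i))))"
      using p'(2) q(2) zero by (simp add: ln_binomial_side sum_subtractf)
    also have "\<dots> = (\<Sum>i\<in>UNIV. t * ((ln (cmod (w $ i)) - ln (cmod (z $ i))) * (A i \<bullet> u)))"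
      by (intro sum.cong) (simp_all add: p'_def slack_add algebra_simps)
    finally show "(\<Sum>i\<in>UNIV. (ln (cmod (w $ i)) - ln (cmod (z $ i))) * (A i \<bullet> u)) = 0"
      using t(1) by (simp flip: sum_distrib_left)
  qed
qed

lemma closed_same_orbit: "closed {(z, w). z \<in> ZP \<and> w \<in> ZF \<and> same_orbit z w}"
proof -
  have cont: "continuous_on UNIV (\<lambda>x. binomial_side p q (fst x) (snd x))" if "p \<in> P" "q \<in> P" for p q
    unfolding binomial_side_def
    by (intro continuous_intros continuous_on_pow0) (use that in \<open>auto simp: mem_P\<close>)
  have "{(z, w). z \<in> ZP \<and> w \<in> ZF \<and> same_orbit z w} = (ZP \<times> ZF) \<inter>
      ({x. \<forall>i. cmod (fst x $ i) *\<^sub>R snd x $ i = cmod (snd x $ i) *\<^sub>R fst x $ i} \<inter>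
       (\<Inter>p\<in>P. \<Inter>q\<in>P. {x. binomial_side p q (fst x) (snd x) = binomial_side q p (fst x) (snd x)}))"
    by (auto simp: same_orbit_iff_binomial)
  also have "closed \<dots>"
    by (intro closed_Int closed_INT ballI closed_Collect_all closed_Collect_eq cont closed_Times
        compact_imp_closed compact_Z_poly compact_Z_fan continuous_intros)
  finally show ?thesis .
qed

section \<open>Torus equivariance and the homeomorphism\<close>

lemma torus_mult_closed:
  assumes t: "t \<in> torus"
  shows "z \<in> ZP \<Longrightarrow> t * z \<in> ZP" "w \<in> ZF \<Longrightarrow> t * w \<in> ZF"
    "same_orbit z w \<Longrightarrow> same_orbit (t * z) (t * w)"
proof -
  have cmod: "cmod ((t * z) $ i) = cmod (z $ i)" for z i
    using t by (simp add: torus_def norm_mult)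
  have t0: "t $ i \<noteq> 0" for i
  proof -
    have "cmod (t $ i) = 1" using t by (simp add: torus_def)
    then show ?thesis by auto
  qed
  show "z \<in> ZP \<Longrightarrow> t * z \<in> ZP" "w \<in> ZF \<Longrightarrow> t * w \<in> ZF"
    unfolding Z_poly_iff Z_fan_iff cmod .
  show "same_orbit z w \<Longrightarrow> same_orbit (t * z) (t * w)"
    unfolding same_orbit_def cmod using t0 by (auto simp flip: mult_scaleR_right)
qed

lemma equivariant_homeomorphism:
  "\<exists>f g. homeomorphism ZP ZF f g \<and> (\<forall>t\<in>torus. \<forall>z\<in>ZP. f (t * z) = t * f z)"
proof -
  define f where "f z = (SOME w. w \<in> ZF \<and> same_orbit z w)" for z
  have f: "f z \<in> ZF" "same_orbit z (f z)" if "z \<in> ZP" for z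
    using someI_ex[of "\<lambda>w. w \<in> ZF \<and> same_orbit z w"] Z_fan_orbit_exists[OF that]
    by (auto simp: f_def)
  have f_eq: "f z = w" if "z \<in> ZP" "w \<in> ZF" "same_orbit z w" for z w
    using Z_fan_orbit_unique f that by blast
  have "(\<lambda>z. (z, f z)) ` ZP = {(z, w). z \<in> ZP \<and> w \<in> ZF \<and> same_orbit z w}"
    using f f_eq by auto
  then have "continuous_on ZP f"
    \<comment> \<open>The graph of \<open>f\<close> is the whole orbit relation, and a closed graph
      with compact target gives continuity.\<close>
    using continuous_from_closed_graph[OF compact_Z_fan, of f ZP] f(1) closed_same_orbit by auto
  moreover have "f ` ZP = ZF"
    using f(1) Z_poly_orbit_exists f_eq by (force simp: image_iff)
  moreover have "inj_on f ZP"
    using f(2) Z_poly_orbit_unique by (metis inj_onI)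
  ultimately obtain g where "homeomorphism ZP ZF f g"
    using homeomorphism_compact[OF compact_Z_poly] by blast
  \<comment> \<open>\<open>t * f z\<close> is a point of \<open>ZF\<close> in the orbit of
    \<open>t * z\<close>, hence the only one.\<close>
  moreover have "f (t * z) = t * f z" if "t \<in> torus" "z \<in> ZP" for t z
    using torus_mult_closed[OF that(1)] f that(2) by (intro f_eq) auto
  ultimately show ?thesis by blast
qed

end

theorem proposition4p1:
  fixes a :: "'m::finite \<Rightarrow> int ^ 'n::finite" and b :: "'m \<Rightarrow> int"
  assumes "\<And>i. primitive_vec (a i)"
    and "polytope_presentation a b"
    and "simple_polytope (polyP a b)"
  shows "Z_poly a b \<subseteq> U_fan a (normal_fan a b) \<and>
    (\<exists>f g. homeomorphism (Z_poly a b) (Z_fan a (normal_fan a b)) f g \<and>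
      (\<forall>t \<in> torus. \<forall>z \<in> Z_poly a b. f (t * z) = t * f z))"
proof -
  interpret simple_presentation a b
    using assms(2,3) by unfold_locales
  show ?thesis
    using Z_poly_subset_U_fan equivariant_homeomorphism by blast
qed

end
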